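(* Let $\mathbb{F}$ be an algebraically closed field of characteristic zero, let $A$ be a finite-dimensional Leibniz algebra over $\mathbb{F}$, let $L\subseteq A$ be a Lie subset of $A$ that spans $A$, and let $M\neq 0$ be a finite-dimensional $A$-module with associated representation $(T,S)$. Suppose that $T_a$ is nilpotent for all $a\in L$. Then $A$ acts nilpotently on $M$, and there exists $0\neq m\in M$ such that $[a,m]=[m,a]=0$ for all $a\in A$.
   Context: A (left) Leibniz algebra over $\mathbb{F}$ is an $\mathbb{F}$-vector space $A$ with a bilinear map $[\,,\,]:A\times A\to A$ satisfying $[a,[b,c]]=[[a,b],c]+[b,[a,c]]$ for all $a,b,c\in A$. A Lie subset of $A$ is a subset closed under the multiplication $[\,,\,]$. A module of $A$ is an $\mathbb{F}$-vector space $M$ with bilinear maps $[\,,\,]:A\times M\to M$ and $[\,,\,]:M\times A\to M$ such that for all $a,b\in A$, $m\in M$: $[a,[b,m]]=[[a,b],m]+[b,[a,m]]$, $[a,[m,b]]=[[a,m],b]+[m,[a,b]]$, $[m,[a,b]]=[[m,a],b]+[a,[m,b]]$. The associated representation $(T,S)$ consists of the linear maps $T,S:A\to \mathrm{End}(M)$ given by $T_a(m)=[a,m]$ and $S_a(m)=[m,a]$. "$A$ acts nilpotently on $M$" means that there is a positive integer $k$ such that every composition of $k$ operators, each of the form $T_a$ or $S_a$ with $a\in A$, is zero on $M$. *)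

theory Defs
  imports Complex_Main "HOL-Computational_Algebra.Polynomial"
begin

definition bilinear_map ::
  "('k::field \<Rightarrow> 'x::ab_group_add \<Rightarrow> 'x) \<Rightarrow> ('k \<Rightarrow> 'y::ab_group_add \<Rightarrow> 'y) \<Rightarrow>
   ('k \<Rightarrow> 'z::ab_group_add \<Rightarrow> 'z) \<Rightarrow> ('x \<Rightarrow> 'y \<Rightarrow> 'z) \<Rightarrow> bool"
  where "bilinear_map s1 s2 s3 f \<longleftrightarrow>
    (\<forall>y. Vector_Spaces.linear s1 s3 (\<lambda>x. f x y)) \<and> (\<forall>x. Vector_Spaces.linear s2 s3 (\<lambda>y. f x y))"

text \<open>Left Leibniz algebras: each left multiplication is a derivation. The underlying vector
  space is the whole type \<open>'a\<close>.\<close>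

locale leibniz_algebra = vector_space scaleA
  for scaleA :: "'k::field \<Rightarrow> 'a::ab_group_add \<Rightarrow> 'a" +
  fixes br :: "'a \<Rightarrow> 'a \<Rightarrow> 'a"
  assumes br_bilinear: "bilinear_map scaleA scaleA scaleA br"
    and leibniz: "br a (br b c) = br (br a b) c + br b (br a c)"

text \<open>Here \<open>lact a m\<close> is $[a,m]$ and \<open>ract m a\<close> is $[m,a]$.\<close>

locale leibniz_module = leibniz_algebra scaleA br + M: vector_space scaleM
  for scaleA :: "'k::field \<Rightarrow> 'a::ab_group_add \<Rightarrow> 'a"
    and br :: "'a \<Rightarrow> 'a \<Rightarrow> 'a"
    and scaleM :: "'k \<Rightarrow> 'm::ab_group_add \<Rightarrow> 'm" +
  fixes lact :: "'a \<Rightarrow> 'm \<Rightarrow> 'm"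
    and ract :: "'m \<Rightarrow> 'a \<Rightarrow> 'm"
  assumes lact_bilinear: "bilinear_map scaleA scaleM scaleM lact"
    and ract_bilinear: "bilinear_map scaleM scaleA scaleM ract"
    and lact_lact: "lact a (lact b m) = lact (br a b) m + lact b (lact a m)"
    and lact_ract: "lact a (ract m b) = ract (lact a m) b + ract m (br a b)"
    and ract_br: "ract m (br a b) = ract (ract m a) b + lact a (ract m b)"

definition lie_subset :: "('a \<Rightarrow> 'a \<Rightarrow> 'a) \<Rightarrow> 'a set \<Rightarrow> bool"
  where "lie_subset br L \<longleftrightarrow> (\<forall>a\<in>L. \<forall>b\<in>L. br a b \<in> L)"

text \<open>The associated representation $(T,S)$: \<open>rep_T lact a\<close> is $T_a$ and \<open>rep_S ract a\<close> is $S_a$.\<close>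

definition rep_T :: "('a \<Rightarrow> 'm \<Rightarrow> 'm) \<Rightarrow> 'a \<Rightarrow> 'm \<Rightarrow> 'm"
  where "rep_T lact a = (\<lambda>m. lact a m)"

definition rep_S :: "('m \<Rightarrow> 'a \<Rightarrow> 'm) \<Rightarrow> 'a \<Rightarrow> 'm \<Rightarrow> 'm"
  where "rep_S ract a = (\<lambda>m. ract m a)"

definition nilpotent_map :: "('m::zero \<Rightarrow> 'm) \<Rightarrow> bool"
  where "nilpotent_map f \<longleftrightarrow> (\<exists>k>0. \<forall>m. (f ^^ k) m = 0)"

definition acts_nilpotently :: "('a \<Rightarrow> 'm \<Rightarrow> 'm::zero) \<Rightarrow> ('m \<Rightarrow> 'a \<Rightarrow> 'm) \<Rightarrow> bool"
  where "acts_nilpotently lact ract \<longleftrightarrow>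
    (\<exists>k>0. \<forall>fs. length fs = k \<longrightarrow> set fs \<subseteq> range (rep_T lact) \<union> range (rep_S ract) \<longrightarrow>
       (\<forall>m. foldr (\<circ>) fs id m = 0))"

end

theory Submission
  imports Defs
begin

text \<open>The operators \<open>T\<^sub>a\<close> satisfy $[T_a,T_b] = T_{[a,b]}$, so $T(L)$ is a commutator-closed set of
  nilpotent maps and Jacobson's theorem on weakly closed sets makes all sufficiently long products
  of operators \<open>T\<^sub>a\<close> vanish. To prove it, let $B \subseteq L$ be such that long products from \<open>B\<close> vanish and
  put $X = B \cup \ker T$. Iterated brackets of elements of \<open>B\<close> with an element of \<open>L\<close> outside
  \<open>span X\<close> end up in $\ker T$, so some \<open>w \<in> L - span X\<close> satisfies $[B,w] \subseteq$ \<open>span X\<close>. Then \<open>w\<close>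
  can be added to \<open>B\<close>, which increases the dimension of \<open>span X\<close>.

  The module axioms give $S_b(T_a + S_a) = 0$. Hence the common kernel of all \<open>S\<^sub>a\<close> is a submodule
  modulo which $S_a = -T_a$, and the vanishing of long words in the \<open>T\<^sub>a\<close> carries over to
  words in both kinds of operators.\<close>

section \<open>Elements annihilated by all words of a given length\<close>

primrec killed_by_words :: "('m \<Rightarrow> 'm::zero) set \<Rightarrow> nat \<Rightarrow> 'm set" where
  "killed_by_words F 0 = {0}"
| "killed_by_words F (Suc k) = {m. \<forall>f\<in>F. f m \<in> killed_by_words F k}"

lemma foldr_comp_eq_0_if_killed:
  assumes "set fs \<subseteq> F" "m \<in> killed_by_words F (length fs)"
  shows "foldr (\<circ>) fs id m = 0"
  using assms
\<comment> \<open>The last list entry is applied first, and it is the one that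
  \<open>killed_by_words\<close> strips.\<close>
proof (induction fs arbitrary: m rule: rev_induct)
  case (snoc f fs)
  have "foldr (\<circ>) (fs @ [f]) id m = foldr (\<circ>) fs id (f m)"
    by (induction fs) auto
  moreover have "foldr (\<circ>) fs id (f m) = 0"
    using snoc.prems by (intro snoc.IH) auto
  ultimately show ?case by (simp only:)
qed simp

lemma killed_by_words_antimono:
  "F \<subseteq> F' \<Longrightarrow> killed_by_words F' k \<subseteq> killed_by_words F k"
  by (induction k) auto

lemma zero_killed_by_words:
  assumes "\<And>f. f \<in> F \<Longrightarrow> f 0 = 0"
  shows "0 \<in> killed_by_words F k"
proof (induction k)
  case (Suc k)
  have "f 0 \<in> killed_by_words F k" if "f \<in> F" for f
    unfolding assms[OF that] by (rule Suc)
  then show ?case by simp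
qed simp

text \<open>On the first nonzero stage of the filtration, every map of \<open>F\<close> leads into
  the preceding stage, which is zero.\<close>

lemma common_kernel_nontrivial:
  fixes F :: "('m::zero \<Rightarrow> 'm) set" and x :: 'm
  assumes "killed_by_words F k = UNIV" "x \<noteq> 0"
    and zero: "\<And>f. f \<in> F \<Longrightarrow> f 0 = 0"
  shows "\<exists>m. m \<noteq> 0 \<and> (\<forall>f\<in>F. f m = 0)"
proof -
  have "killed_by_words F k \<noteq> {0}" using assms(1,2) by blast
  then obtain j where j: "killed_by_words F j \<noteq> {0}" "\<And>i. i < j \<Longrightarrow> killed_by_words F i = {0}"
    using exists_least_iff[of "\<lambda>k. killed_by_words F k \<noteq> {0}"] by metis
  obtain i where i: "j = Suc i"
    using j(1) by (cases j) simp_all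
  have "0 \<in> killed_by_words F j"
    using zero by (rule zero_killed_by_words)
  with j(1) obtain m where "m \<in> killed_by_words F j" "m \<noteq> 0" by blast
  moreover have "killed_by_words F i = {0}"
    using j(2) i by simp
  ultimately show ?thesis
    unfolding i by (intro exI[of _ m]) simp
qed

section \<open>Jacobson's theorem on weakly closed sets\<close>

locale commutator_action = A: vector_space scaleA + M: vector_space scaleM
  for scaleA :: "'k::field \<Rightarrow> 'a::ab_group_add \<Rightarrow> 'a"
    and scaleM :: "'k \<Rightarrow> 'm::ab_group_add \<Rightarrow> 'm" +
  fixes br :: "'a \<Rightarrow> 'a \<Rightarrow> 'a"
    and lact :: "'a \<Rightarrow> 'm \<Rightarrow> 'm"
  assumes lact_bilinear: "bilinear_map scaleA scaleM scaleM lact"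
    and lact_br: "lact (br a b) m = lact a (lact b m) - lact b (lact a m)"
begin

sublocale left: Vector_Spaces.linear scaleA scaleM "\<lambda>a. lact a m" for m
  using lact_bilinear by (simp add: bilinear_map_def)

sublocale right: Vector_Spaces.linear scaleM scaleM "lact a" for a
  using lact_bilinear by (simp add: bilinear_map_def)

abbreviation killed :: "'a set \<Rightarrow> nat \<Rightarrow> 'm set" where
  "killed X \<equiv> killed_by_words (lact ` X)"

definition kernel :: "'a set" where
  "kernel = {a. \<forall>m. lact a m = 0}"

lemma br_in_kernel: "a \<in> kernel \<Longrightarrow> br a b \<in> kernel"
  by (simp add: kernel_def lact_br right.zero)

lemma subspace_killed: "M.subspace (killed X k)"
  by (induction k) (auto simp: M.subspace_def right.zero right.add right.scale)

text \<open>As each stage is a subspace, so is the set of all \<open>a\<close> sending a given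
  \<open>m\<close> into it.\<close>

lemma killed_span: "killed (A.span X) k = killed X k"
proof (induction k)
  case (Suc k)
  have "lact a m \<in> killed X k"
    if "a \<in> A.span X" "\<forall>b\<in>X. lact b m \<in> killed X k" for a m
  proof -
    have "A.subspace {a. lact a m \<in> killed X k}"
      using subspace_killed[of X k]
      by (auto simp: A.subspace_def M.subspace_def left.zero left.add left.scale)
    with that show ?thesis
      using A.span_minimal[of X "{a. lact a m \<in> killed X k}"] by blast
  qed
  then have "(\<forall>a\<in>A.span X. lact a m \<in> killed X k) \<longleftrightarrow> (\<forall>a\<in>X. lact a m \<in> killed X k)" for m
    using A.span_base by blast
  with Suc show ?case by simp
qed simp

lemma killed_mono: "i \<le> j \<Longrightarrow> killed X i \<subseteq> killed X j"
proof (rule lift_Suc_mono_le)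
  show "killed X k \<subseteq> killed X (Suc k)" for k
    by (induction k) (auto simp: right.zero)
qed

text \<open>Write \<open>lact h (lact w m)\<close> as
  \<open>lact (br h w) m + lact w (lact h m)\<close>. The first term drops a stage because
  \<open>br h w\<close> lies in \<open>A.span X\<close>, the second by induction.\<close>

lemma killed_invariant:
  assumes w: "\<And>h. h \<in> X \<Longrightarrow> br h w \<in> A.span X"
    and "m \<in> killed X k"
  shows "lact w m \<in> killed X k"
  using assms(2)
proof (induction k arbitrary: m)
  case (Suc k)
  have "lact h (lact w m) \<in> killed X k" if "h \<in> X" for h
  proof -
    have "m \<in> killed (A.span X) (Suc k)"
      using Suc.prems by (simp only: killed_span)
    then have "lact (br h w) m \<in> killed (A.span X) k"
      using w[OF that] by simp
    then have "lact (br h w) m \<in> killed X k"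
      by (simp only: killed_span)
    moreover have "lact w (lact h m) \<in> killed X k"
      using Suc that by auto
    ultimately have "lact (br h w) m + lact w (lact h m) \<in> killed X k"
      by (rule M.subspace_add[OF subspace_killed])
    then show ?thesis
      by (simp add: lact_br)
  qed
  then show ?case by simp
qed (simp add: right.zero)

lemma killed_insert:
  assumes w: "\<And>h. h \<in> X \<Longrightarrow> br h w \<in> A.span X"
    and nil: "\<And>m. (lact w ^^ N) m = 0"
  shows "killed X k \<subseteq> killed (insert w X) (k * N)"
proof (induction k)
  case (Suc k)
  \<comment> \<open>A letter from \<open>X\<close> drops \<open>m\<close> into
    \<open>killed X k\<close>, and a letter \<open>w\<close> lowers \<open>j\<close> by one without
    leaving \<open>killed X (Suc k)\<close>. So passing one stage costs at most \<open>N\<close>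
    letters.\<close>
  have "m \<in> killed (insert w X) (k * N + j)"
    if "m \<in> killed X (Suc k)" "(lact w ^^ j) m \<in> killed X k" for j m
    using that
  proof (induction j arbitrary: m)
    case 0
    with Suc show ?case by auto
  next
    case (Suc j)
    have "lact w m \<in> killed (insert w X) (k * N + j)"
      using Suc.prems killed_invariant[OF w, of m "Suc k"]
      by (intro Suc.IH) (simp_all add: funpow_swap1)
    moreover have "lact h m \<in> killed (insert w X) (k * N + j)" if "h \<in> X" for h
      using that Suc.prems \<open>killed X k \<subseteq> killed (insert w X) (k * N)\<close>
        killed_mono[of "k * N" "k * N + j" "insert w X"] by auto
    ultimately show ?case by auto
  qed
  from this[of _ N] show ?case
    using nil M.subspace_0[OF subspace_killed] by (auto simp: add.commute)
qed simp

text \<open>Bracketing with \<open>h\<close> turns \<open>T\<^sub>y\<close> into \<open>T\<^sub>h T\<^sub>y - T\<^sub>y T\<^sub>h\<close>, which lowers the degree in the filtration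
  by one more than \<open>T\<^sub>y\<close> does.\<close>

lemma br_lowers_filtration:
  assumes y: "\<And>i m. m \<in> killed X i \<Longrightarrow> lact y m \<in> killed X (n + i - j)"
    and "h \<in> X" "m \<in> killed X i"
  shows "lact (br h y) m \<in> killed X (n + i - Suc j)"
proof (cases i)
  case 0
  with assms(3) show ?thesis
    by (simp add: right.zero M.subspace_0[OF subspace_killed])
next
  case (Suc i')
  have "lact h (lact y m) \<in> killed X (n + i - Suc j)"
  \<comment> \<open>The subtraction is truncated: at value 0, \<open>lact y m\<close> is already 0
    because \<open>killed X 0\<close> is zero.\<close>
  proof (cases "n + i - j")
    case 0
    with y[OF assms(3)] show ?thesis
      by (simp add: right.zero M.subspace_0[OF subspace_killed])
  next
    case (Suc l)
    then have "n + i - Suc j = l" by simp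
    with y[OF assms(3)] Suc \<open>h \<in> X\<close> show ?thesis by simp
  qed
  moreover have "lact h m \<in> killed X i'"
    using assms Suc by simp
  then have "lact y (lact h m) \<in> killed X (n + i - Suc j)"
    using y Suc by fastforce
  ultimately show ?thesis
    unfolding lact_br by (rule M.subspace_diff[OF subspace_killed])
qed

text \<open>Without such a \<open>w\<close>, bracketing could go on outside \<open>A.span X\<close>
  forever. Brackets are taken with \<open>B\<close> rather than \<open>X\<close> so that they remain
  in \<open>L\<close>, which need not contain \<open>kernel\<close>.\<close>

lemma normalizing_element_exists:
  assumes L: "lie_subset br L" and B: "B \<subseteq> L" "B \<subseteq> X" and ker: "kernel \<subseteq> X"
    and nil: "killed X n = UNIV"
    and x: "x \<in> L - A.span X"
  shows "\<exists>w\<in>L - A.span X. \<forall>b\<in>B. br b w \<in> A.span X"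
proof (rule ccontr)
  assume none: "\<not> ?thesis"
  have "\<exists>y\<in>L - A.span X. \<forall>i. \<forall>m\<in>killed X i. lact y m \<in> killed X (n + i - j)" for j
  proof (induction j)
    case 0
    have "killed X (n + i - 0) = UNIV" for i
      using nil killed_mono[of n "n + i - 0" X] by auto
    with x show ?case by blast
  next
    case (Suc j)
    then obtain y where y: "y \<in> L - A.span X"
      and low: "\<And>i m. m \<in> killed X i \<Longrightarrow> lact y m \<in> killed X (n + i - j)" by blast
    from none y obtain b where b: "b \<in> B" "br b y \<notin> A.span X" by blast
    then have "br b y \<in> L - A.span X"
      using L B y by (auto simp: lie_subset_def)
    moreover have "lact (br b y) m \<in> killed X (n + i - Suc j)" if "m \<in> killed X i" for i m
      using br_lowers_filtration[OF low _ that] b B by blast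
    ultimately show ?case by blast
  qed
  \<comment> \<open>After \<open>n + n\<close> brackets, stage \<open>n\<close>, which is
    everything, is sent into stage 0, which is zero.\<close>
  from this[of "n + n"] obtain y where y: "y \<in> L - A.span X"
    and "\<forall>i. \<forall>m\<in>killed X i. lact y m \<in> killed X (n + i - (n + n))" by blast
  then have "y \<in> kernel"
    using nil by (auto simp: kernel_def dest!: spec[of _ n])
  with ker y show False
    using A.span_base by blast
qed

theorem jacobson_weakly_closed:
  assumes "\<exists>Basis. finite_dimensional_vector_space scaleA Basis"
    and L: "lie_subset br L"
    and nil: "\<And>a. a \<in> L \<Longrightarrow> nilpotent_map (lact a)"
  shows "\<exists>n. killed L n = UNIV"
proof -
  obtain Basis where "finite_dimensional_vector_space scaleA Basis"
    using assms(1) by blast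
  then interpret A: finite_dimensional_vector_space scaleA Basis .
  \<comment> \<open>Induction on the codimension of the span of \<open>B \<union> kernel\<close>, to
    be started from the empty \<open>B\<close>.\<close>
  have extend: "\<exists>n. killed L n = UNIV" if "B \<subseteq> L" "killed (B \<union> kernel) n = UNIV" for B n
    using that
  proof (induction "A.dim (UNIV :: 'a set) - A.dim (B \<union> kernel)" arbitrary: B n rule: less_induct)
    case less
    let ?X = "B \<union> kernel"
    show ?case
    proof (cases "L \<subseteq> A.span ?X")
      case True
      then have "killed (A.span ?X) n \<subseteq> killed L n"
        by (intro killed_by_words_antimono image_mono)
      with less.prems show ?thesis
        by (auto simp: killed_span)
    next
      case False
      then obtain w where w: "w \<in> L" "w \<notin> A.span ?X" "\<forall>b\<in>B. br b w \<in> A.span ?X"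
        using normalizing_element_exists[OF L \<open>B \<subseteq> L\<close> _ _ less.prems(2)] by blast
      have X: "insert w B \<union> kernel = insert w ?X" by simp
      obtain N where "\<And>m. (lact w ^^ N) m = 0"
        using nil[OF w(1)] by (auto simp: nilpotent_map_def)
      \<comment> \<open>For \<open>h\<close> in \<open>kernel\<close> the bracket stays in
        \<open>kernel\<close>, so the choice of \<open>w\<close> only has to handle
        \<open>B\<close>.\<close>
      moreover have "br h w \<in> A.span ?X" if "h \<in> ?X" for h
        using that w(3) br_in_kernel by (auto intro: A.span_base)
      ultimately have "killed (insert w B \<union> kernel) (n * N) = UNIV"
        unfolding X using killed_insert[of ?X w N n] less.prems(2) by auto
      moreover have "A.dim (insert w B \<union> kernel) = Suc (A.dim ?X)"
        unfolding X using w(2) by (simp add: A.dim_insert)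
      moreover have "A.dim (insert w B \<union> kernel) \<le> A.dim (UNIV :: 'a set)"
        by (rule A.dim_subset) simp
      ultimately show ?thesis
        using less.prems(1) w(1) by (intro less.hyps[of "insert w B" "n * N"]) auto
    qed
  qed
  have "killed ({} \<union> kernel) 1 = UNIV"
    by (auto simp: kernel_def)
  then show ?thesis
    by (rule extend[rotated]) simp
qed

end

section \<open>From the left action to both actions\<close>

context leibniz_module
begin

sublocale commutator_action scaleA scaleM br lact
proof unfold_locales
  show "lact (br a b) m = lact a (lact b m) - lact b (lact a m)" for a b m
    by (subst lact_lact[of a b m]) simp
qed (rule lact_bilinear)

sublocale ract_left: Vector_Spaces.linear scaleM scaleM "\<lambda>m. ract m a" for a
  using ract_bilinear by (simp add: bilinear_map_def)

text \<open>Substituting \<open>ract_br\<close> into \<open>lact_ract\<close> leaves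
  \<open>lact a (ract m b)\<close> on both sides, where it cancels.\<close>

lemma ract_lact_plus_ract: "ract (lact a m + ract m a) b = 0"
  using lact_ract[of a m b, unfolded ract_br]
  by (simp only: ract_left.add add.assoc[symmetric] add_cancel_left_left add_cancel_left_right add_cancel_right_left)

text \<open>The first \<open>n\<close> letters move every element into the common kernel of the
  right actions. Inside it only words in \<open>lact\<close> can be nonzero, and \<open>n\<close>
  more letters kill those.\<close>

lemma killed_by_both_actions:
  assumes "killed UNIV n = UNIV"
  shows "killed_by_words (range (rep_T lact) \<union> range (rep_S ract)) (n + n) = UNIV"
proof -
  let ?F = "range (rep_T lact) \<union> range (rep_S ract)"
  define K where "K = {m. \<forall>a. ract m a = 0}"
  have lact_K: "lact a m \<in> K" if "m \<in> K" for a m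
    using that ract_lact_plus_ract[of a m] by (simp add: K_def)
  have zero: "0 \<in> killed_by_words ?F k" for k
    by (rule zero_killed_by_words) (auto simp: rep_T_def rep_S_def)
  have in_K: "m \<in> killed_by_words ?F k" if "m \<in> K" "m \<in> killed UNIV k" for m k
    using that
  proof (induction k arbitrary: m)
    case (Suc k)
    have "lact a m \<in> killed_by_words ?F k" for a
      using Suc.prems by (intro Suc.IH lact_K) simp_all
    moreover have "ract m a \<in> killed_by_words ?F k" for a
    proof -
      have "ract m a = 0"
        using Suc.prems(1) by (simp add: K_def)
      then show ?thesis
        by (simp only: zero)
    qed
    ultimately show ?case
      by (auto simp: rep_T_def rep_S_def)
  qed simp
  have "u + v \<in> killed_by_words ?F (n + i)" if "u \<in> killed UNIV i" "v \<in> K" for u v i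
    using that
  proof (induction i arbitrary: u v)
    case 0
    then have "u + v \<in> K" by simp
    then show ?case
      using in_K assms by (simp only: add_0_right UNIV_I)
  next
    case (Suc i)
    have "lact a (u + v) \<in> killed_by_words ?F (n + i)" for a
      unfolding right.add using Suc.prems by (intro Suc.IH lact_K) simp_all
    moreover have "ract (u + v) a \<in> killed_by_words ?F (n + i)" for a
    proof -
      \<comment> \<open>\<open>ract u a\<close> is split as \<open>- lact a u\<close> plus an
        element of \<open>K\<close>, which restores the shape \<open>u + v\<close> with the index
        lowered by one.\<close>
      have "- lact a u \<in> killed UNIV i"
        using Suc.prems M.subspace_neg[OF subspace_killed] by simp
      moreover have "lact a u + ract u a \<in> K"
        by (simp add: K_def ract_lact_plus_ract)
      ultimately have "- lact a u + (lact a u + ract u a) \<in> killed_by_words ?F (n + i)"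
        by (rule Suc.IH)
      moreover have "ract (u + v) a = ract u a"
        using Suc.prems(2) by (simp add: ract_left.add K_def)
      ultimately show ?thesis by simp
    qed
    ultimately show ?case
      by (auto simp: rep_T_def rep_S_def)
  qed
  from this[of _ n 0] have "m \<in> killed_by_words ?F (n + n)" for m
    using assms by (simp add: K_def)
  then show ?thesis by blast
qed

end

theorem theorem4p5:
  fixes scaleA :: "'k::{alg_closed_field, field_char_0} \<Rightarrow> 'a::ab_group_add \<Rightarrow> 'a"
    and br :: "'a \<Rightarrow> 'a \<Rightarrow> 'a"
    and scaleM :: "'k \<Rightarrow> 'm::ab_group_add \<Rightarrow> 'm"
    and lact :: "'a \<Rightarrow> 'm \<Rightarrow> 'm"
    and ract :: "'m \<Rightarrow> 'a \<Rightarrow> 'm"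
    and L :: "'a set"
  assumes "leibniz_algebra scaleA br"
    and "\<exists>B. finite_dimensional_vector_space scaleA B"
    and "lie_subset br L"
    and "module.span scaleA L = UNIV"
    and "leibniz_module scaleA br scaleM lact ract"
    and "\<exists>B. finite_dimensional_vector_space scaleM B"
    and "\<exists>m::'m. m \<noteq> 0"
    and "\<forall>a\<in>L. nilpotent_map (rep_T lact a)"
  shows "acts_nilpotently lact ract \<and> (\<exists>m. m \<noteq> 0 \<and> (\<forall>a. lact a m = 0 \<and> ract m a = 0))"
proof -
  interpret leibniz_module scaleA br scaleM lact ract by fact
  let ?F = "range (rep_T lact) \<union> range (rep_S ract)"
  obtain x :: 'm where x: "x \<noteq> 0" using assms(7) by blast
  have "nilpotent_map (lact a)" if "a \<in> L" for a
    using assms(8) that by (simp add: rep_T_def)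
  from jacobson_weakly_closed[OF assms(2,3) this]
  obtain n where "killed L n = UNIV" by blast
  then have n: "killed UNIV n = UNIV"
    using killed_span[of L n] assms(4) by simp
  then have F: "killed_by_words ?F (n + n) = UNIV"
    by (rule killed_by_both_actions)
  \<comment> \<open>Nilpotent action asks for words of positive length; \<open>n = 0\<close> would
    make the module zero, against \<open>x\<close>.\<close>
  have "n > 0"
    using n x by (cases n) auto
  then have "acts_nilpotently lact ract"
    unfolding acts_nilpotently_def using F
    by (intro exI[of _ "n + n"]) (auto intro!: foldr_comp_eq_0_if_killed[where F = ?F])
  moreover have "f 0 = 0" if "f \<in> ?F" for f
    using that by (auto simp: rep_T_def rep_S_def)
  then obtain m where "m \<noteq> 0" "\<forall>f\<in>?F. f m = 0"
    using common_kernel_nontrivial[OF F x] by blast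
  then have "rep_T lact a m = 0 \<and> rep_S ract a m = 0" for a
    by blast
  with \<open>m \<noteq> 0\<close> have "\<exists>m. m \<noteq> 0 \<and> (\<forall>a. lact a m = 0 \<and> ract m a = 0)"
    by (auto simp: rep_T_def rep_S_def)
  ultimately show ?thesis by blast
qed

end
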